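(* Let $p\ge1$ be an integer and $x$ a parameter. For a positive integer $m$, let $RE_m^{(p)}$ be the $m\times m$ tridiagonal matrix with entries (indices starting at $1$) \[ \left(RE_m^{(p)}\right)_{k,k}=x-\frac p2,\qquad \left(RE_m^{(p)}\right)_{k+1,k}=1,\qquad \left(RE_m^{(p)}\right)_{k,k+1}=-\frac{k(k+p-1)}{4}, \] and all other entries $0$. Then for every nonnegative integer $n\le m$, \[ \left[\left(RE_m^{(p)}\right)^n\right]_{1,1}=E_n^{(p)}(x). \]
   Context: The higher-order Euler polynomials $E_n^{(p)}(x)$ are defined by $\left(\frac{2}{e^{z}+1}\right)^{p}e^{xz}=\sum_{n\ge0}E_{n}^{(p)}(x)\frac{z^{n}}{n!}$. *)

theory Defs
  imports "HOL-Computational_Algebra.Formal_Power_Series" "Jordan_Normal_Form.Matrix"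
begin

text \<open>
  The higher-order Euler polynomials, read off from their exponential generating function
  \<open>(2 / (e^z + 1))^p * e^(x z)\<close> in the formal variable \<open>z\<close>. The divisor has constant
  coefficient 2, so the quotient is the genuine one. The parameter \<open>x\<close> ranges over an
  arbitrary field of characteristic 0, which includes rational function fields, where it may
  be an indeterminate.
\<close>

definition euler_egf :: "nat \<Rightarrow> 'a::field_char_0 \<Rightarrow> 'a fps" where
  "euler_egf p x = (fps_const 2 / (fps_exp 1 + 1)) ^ p * fps_exp x"

definition euler_poly :: "nat \<Rightarrow> nat \<Rightarrow> 'a::field_char_0 \<Rightarrow> 'a" where
  "euler_poly p n x = fact n * fps_nth (euler_egf p x) n"

text \<open>Row and column indices of \<open>RE_entry\<close> start at 1; those of library matrices start at 0.\<close>

definition RE_entry :: "nat \<Rightarrow> 'a::field_char_0 \<Rightarrow> nat \<Rightarrow> nat \<Rightarrow> 'a" where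
  "RE_entry p x k l =
     (if l = k then x - of_nat p / 2
      else if k = l + 1 then 1
      else if l = k + 1 then - (of_nat k * (of_nat k + of_nat p - 1) / 4)
      else 0)"

definition RE :: "nat \<Rightarrow> nat \<Rightarrow> 'a::field_char_0 \<Rightarrow> 'a mat" where
  "RE m p x = mat m m (\<lambda>(i, j). RE_entry p x (i + 1) (j + 1))"

end

(*
  Put g = 2 / (e^z + 1), w = 1 - g = tanh (z / 2) and F = g^p e^(x z). From g' = - g (1 + w) / 2 and
  w' = (1 - w^2) / 2 one gets
    (w^j F)' = (j / 2) w^(j-1) F + (x - p / 2) w^j F - ((p + j) / 2) w^(j+1) F.
  After rescaling w^j F by d_j = (-1/2)^j p (p + 1) ... (p + j - 1), these equations are the recurrence
  satisfied by the first row of the powers of the matrix. Truncation to size m does no harm up to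
  the m-th power, because w^m has order m.
*)

theory Submission imports Defs begin

definition logistic_fps :: "'a::field_char_0 fps" where
  "logistic_fps = fps_const 2 / (fps_exp 1 + 1)"

text \<open>The scalar is the d_j of the overview. It is chosen so that d_(j+1) = -((p + j) / 2)
  d_j, which turns the coefficient of the next series into the subdiagonal entry 1.\<close>

definition row_egf :: "nat \<Rightarrow> 'a::field_char_0 \<Rightarrow> nat \<Rightarrow> 'a fps" where
  "row_egf p x j = fps_const ((- 1 / 2) ^ j * pochhammer (of_nat p) j)
     * ((1 - logistic_fps) ^ j * euler_egf p x)"

lemma euler_egf_altdef: "euler_egf p x = logistic_fps ^ p * fps_exp x"
  by (simp only: euler_egf_def logistic_fps_def)

lemma logistic_fps_mult: "logistic_fps * (fps_exp 1 + 1 :: 'a::field_char_0 fps) = 2"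
proof -
  have "fps_nth (fps_exp 1 + 1 :: 'a fps) 0 \<noteq> 0" by simp
  then show ?thesis
    by (simp add: logistic_fps_def fps_divide_unit mult.assoc inverse_mult_eq_1 numeral_fps_const)
qed

lemma logistic_fps_nth_0: "fps_nth logistic_fps 0 = (1 :: 'a::field_char_0)"
  using arg_cong[OF logistic_fps_mult[where 'a = 'a], of "\<lambda>f. fps_nth f 0"]
  by (simp add: numeral_fps_const)

lemma fps_deriv_logistic:
  "2 * fps_deriv logistic_fps = logistic_fps * (logistic_fps - 2 :: 'a::field_char_0 fps)"
proof -
  let ?g = "logistic_fps :: 'a fps" and ?D = "fps_exp 1 + 1 :: 'a fps"
  have D: "?g * ?D = 2" by (rule logistic_fps_mult)
  have "fps_deriv (?g * ?D) = 0" unfolding D by (simp add: numeral_fps_const)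
  then have *: "fps_deriv ?g * ?D + ?g * (?D - 1) = 0" by (simp add: add.commute)
  \<comment> \<open>Writing 2 as g D avoids dividing by D: the product of g' and D is then read off
    from \<open>*\<close>, and e^z enters only as D - 1.\<close>
  have "2 * fps_deriv ?g = ?g * ?D * fps_deriv ?g" by (simp only: D)
  also have "\<dots> = ?g * (fps_deriv ?g * ?D)" by (simp only: ac_simps)
  also have "\<dots> = ?g * - (?g * (?D - 1))" using * by (simp only: add_eq_0_iff2)
  also have "\<dots> = ?g * (?g - ?g * ?D)" by (simp add: algebra_simps)
  finally show ?thesis unfolding D .
qed

text \<open>The extra factor f absorbs the exponent n - 1 of the power rule, so n = 0 needs no
  separate treatment later; f is cancelled where it is nonzero.\<close>

lemma fps_deriv_power_mult:
  fixes f :: "'a::comm_ring_1 fps"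
  shows "fps_deriv (f ^ n) * f = of_nat n * fps_deriv f * f ^ n"
  unfolding fps_deriv_power fps_of_nat by (cases n) (simp_all add: ac_simps)

lemma fps_deriv_euler_egf:
  fixes x :: "'a::field_char_0"
  shows "2 * fps_deriv (euler_egf p x)
    = (fps_const (2 * x) - of_nat p * (1 + (1 - logistic_fps))) * euler_egf p x"
proof -
  let ?g = "logistic_fps :: 'a fps"
  have g0: "?g \<noteq> 0" using logistic_fps_nth_0[where 'a = 'a] by auto
  have "(2 * fps_deriv (?g ^ p)) * ?g = of_nat p * ?g ^ p * (2 * fps_deriv ?g)"
    using fps_deriv_power_mult[of ?g p] by (simp add: algebra_simps)
  also have "\<dots> = (of_nat p * ?g ^ p * (?g - 2)) * ?g"
    unfolding fps_deriv_logistic by (simp only: ac_simps)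
  finally have power: "2 * fps_deriv (?g ^ p) = of_nat p * ?g ^ p * (?g - 2)" using g0 by simp
  have "2 * fps_deriv (euler_egf p x)
      = (2 * fps_deriv (?g ^ p)) * fps_exp x + ?g ^ p * (2 * fps_const x * fps_exp x)"
    by (simp add: euler_egf_altdef algebra_simps)
  also have "\<dots> = (2 * fps_const x - of_nat p * (1 + (1 - ?g))) * euler_egf p x"
    unfolding power by (simp add: euler_egf_altdef algebra_simps)
  finally show ?thesis by (simp add: numeral_fps_const)
qed

text \<open>Product rule with 2 w' = 1 - w^2, doubled to avoid halves. At j = 0 the truncated
  exponent j - 1 is harmless because its term carries the factor j.\<close>

lemma fps_deriv_row_aux:
  fixes p :: nat and x :: "'a::field_char_0"
  defines "w \<equiv> 1 - logistic_fps" and "F \<equiv> euler_egf p x"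
  shows "2 * fps_deriv (w ^ j * F)
    = of_nat j * (w ^ (j - 1) * F) + fps_const (2 * x - of_nat p) * (w ^ j * F)
      - of_nat (p + j) * (w ^ Suc j * F)"
proof -
  have w: "2 * fps_deriv w = 1 - w * w"
    using fps_deriv_logistic[where 'a = 'a] by (simp add: w_def algebra_simps)
  have F: "2 * fps_deriv F = (fps_const (2 * x) - of_nat p * (1 + w)) * F"
    unfolding F_def w_def by (rule fps_deriv_euler_egf)
  have "2 * fps_deriv (w ^ j) = of_nat j * w ^ (j - 1) * (2 * fps_deriv w)"
    by (simp add: fps_deriv_power fps_of_nat algebra_simps)
  also have "\<dots> = of_nat j * w ^ (j - 1) - of_nat j * w ^ Suc j"
    unfolding w by (cases j) (simp_all add: algebra_simps)
  finally have wj: "2 * fps_deriv (w ^ j) = of_nat j * w ^ (j - 1) - of_nat j * w ^ Suc j" .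
  have "2 * fps_deriv (w ^ j * F)
      = (2 * fps_deriv (w ^ j)) * F + w ^ j * (2 * fps_deriv F)"
    by (simp add: algebra_simps)
  also have "\<dots> = of_nat j * (w ^ (j - 1) * F) + (fps_const (2 * x) - of_nat p) * (w ^ j * F)
      - of_nat (p + j) * (w ^ Suc j * F)"
    unfolding wj F by (simp add: algebra_simps)
  also have "fps_const (2 * x) - of_nat p = fps_const (2 * x - of_nat p)"
    by (simp add: fps_of_nat[symmetric])
  finally show ?thesis .
qed

text \<open>Rescaling gives -((p + j) / 2) d_j = d_(j+1) and (j / 2) d_j = -(j (j + p - 1) / 4)
  d_(j-1), so the coefficients become the entries of column j of the matrix.\<close>

lemma fps_deriv_row_egf:
  fixes x :: "'a::field_char_0"
  shows "fps_deriv (row_egf p x j)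
    = fps_const (x - of_nat p / 2) * row_egf p x j + row_egf p x (Suc j)
      - (if j = 0 then 0
         else fps_const (of_nat j * (of_nat j + of_nat p - 1) / 4) * row_egf p x (j - 1))"
proof -
  define d :: "nat \<Rightarrow> 'a" where "d j = (- 1 / 2) ^ j * pochhammer (of_nat p) j" for j
  define H where "H j = (1 - logistic_fps) ^ j * euler_egf p x" for j
  have row: "row_egf p x j = fps_const (d j) * H j" for j
    by (simp add: row_egf_def d_def H_def)
  have d_Suc: "d (Suc j) = - (of_nat p + of_nat j) / 2 * d j" for j
    by (simp add: d_def pochhammer_Suc algebra_simps)
  have H: "2 * fps_deriv (H j) = of_nat j * H (j - 1) + fps_const (2 * x - of_nat p) * H j
      - of_nat (p + j) * H (Suc j)"
    unfolding H_def by (rule fps_deriv_row_aux)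
  show ?thesis
  \<comment> \<open>Passing to coefficients moves the identity into the field, where division by 2
    is available.\<close>
  proof (rule fps_ext)
    fix n
    have Hn: "2 * fps_nth (fps_deriv (H j)) n = of_nat j * fps_nth (H (j - 1)) n
        + (2 * x - of_nat p) * fps_nth (H j) n - of_nat (p + j) * fps_nth (H (Suc j)) n"
      using arg_cong[OF H, of "\<lambda>f. fps_nth f n"]
      by (simp add: numeral_fps_const flip: fps_of_nat del: fps_deriv_nth)
    have eq: "fps_nth (fps_deriv (H j)) n = (of_nat j * fps_nth (H (j - 1)) n
        + (2 * x - of_nat p) * fps_nth (H j) n - of_nat (p + j) * fps_nth (H (Suc j)) n) / 2"
      unfolding Hn[symmetric] by simp
    have "fps_nth (fps_deriv (row_egf p x j)) n = d j * fps_nth (fps_deriv (H j)) n"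
      by (simp add: row)
    also have "\<dots> = fps_nth (fps_const (x - of_nat p / 2) * row_egf p x j + row_egf p x (Suc j)
        - (if j = 0 then 0
           else fps_const (of_nat j * (of_nat j + of_nat p - 1) / 4) * row_egf p x (j - 1))) n"
      unfolding eq by (cases j) (simp_all add: row d_Suc field_simps)
    finally show "fps_nth (fps_deriv (row_egf p x j)) n = \<dots>" .
  qed
qed

text \<open>The series w has zero constant term, so w^j has order at least j.\<close>

lemma row_egf_nth_eq_0:
  assumes "n < j"
  shows "fps_nth (row_egf p x j) n = 0"
proof -
  have "fps_nth (1 - logistic_fps :: 'a fps) 0 = 0" by (simp add: logistic_fps_nth_0)
  then have "fps_nth ((1 - logistic_fps :: 'a fps) ^ j) i = 0" if "i < j" for i
    using that by (rule startsby_zero_power_prefix[rule_format])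
  then show ?thesis
    using assms by (simp add: row_egf_def fps_mult_nth)
qed

lemma RE_power_first_row:
  fixes x :: "'a::field_char_0"
  assumes "n \<le> m" and "j < m"
  shows "(RE m p x ^\<^sub>m n) $$ (0, j) = fact n * fps_nth (row_egf p x j) n"
  using assms
proof (induction n arbitrary: j)
  case 0
  \<comment> \<open>This matches entry (0, 0) of the identity matrix; the entries with j > 0 vanish
    by the order of w^j.\<close>
  have "fps_nth (euler_egf p x) 0 = 1"
    by (simp add: euler_egf_altdef fps_nth_power_0 logistic_fps_nth_0)
  then have "fps_nth (row_egf p x 0) 0 = 1" by (simp add: row_egf_def)
  then show ?case using 0 by (cases j) (simp_all add: RE_def row_egf_nth_eq_0)
next
  case (Suc n)
  let ?u = "\<lambda>j. fact n * fps_nth (row_egf p x j) n"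
  let ?c = "of_nat j * (of_nat j + of_nat p - 1) / 4 :: 'a"
  have carr: "RE m p x \<in> carrier_mat m m" by (simp add: RE_def)
  then have carrn: "RE m p x ^\<^sub>m n \<in> carrier_mat m m" by (rule pow_carrier_mat)
  have "(RE m p x ^\<^sub>m Suc n) $$ (0, j)
      = (\<Sum>i<m. (RE m p x ^\<^sub>m n) $$ (0, i) * RE m p x $$ (i, j))"
    using carr carrn Suc.prems by (simp add: scalar_prod_def atLeast0LessThan)
  also have "\<dots> = (\<Sum>i<m. ?u i * RE_entry p x (i + 1) (j + 1))"
    using Suc by (intro sum.cong) (auto simp: RE_def)
  \<comment> \<open>Column j meets only the rows j, j + 1 and j - 1. In indices from 0, the
    superdiagonal entry in row j - 1 is \<open>- ?c\<close>.\<close>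
  also have "\<dots> = (\<Sum>i<m. (if i = j then ?u j * (x - of_nat p / 2) else 0)
      + (if i = Suc j then ?u (Suc j) else 0)
      + (if Suc i = j then - ?c * ?u (j - 1) else 0))"
    by (intro sum.cong) (auto simp: RE_entry_def)
  also have "\<dots> = ?u j * (x - of_nat p / 2) + ?u (Suc j)
      + (if j = 0 then 0 else - ?c * ?u (j - 1))"
  proof -
    \<comment> \<open>In the last column the row j + 1 is cut off, but then n < m = j + 1 and the
      missing term is zero anyway.\<close>
    have "?u (Suc j) = 0" if "\<not> Suc j < m"
      using that Suc.prems by (simp add: row_egf_nth_eq_0)
    then show ?thesis
      using Suc.prems by (cases j) (auto simp: sum.distrib)
  qed
  also have "\<dots> = fact n * fps_nth (fps_deriv (row_egf p x j)) n"
    unfolding fps_deriv_row_egf by (simp add: algebra_simps)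
  also have "\<dots> = fact (Suc n) * fps_nth (row_egf p x j) (Suc n)"
    by (simp add: algebra_simps)
  finally show ?case .
qed

theorem theorem3p5:
  fixes p m n :: nat and x :: "'a::field_char_0"
  assumes "p \<ge> 1" and "m \<ge> 1" and "n \<le> m"
  shows "(RE m p x ^\<^sub>m n) $$ (0, 0) = euler_poly p n x"
  \<comment> \<open>In column 0 both the scalar and the power of w are 1, which leaves
    \<open>euler_egf p x\<close>.\<close>
  using assms RE_power_first_row[of n m 0 p x] by (simp add: euler_poly_def row_egf_def)

end
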